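(* Let $n\ge1$ and let $\Bbbk$ be a field. The decomposition of $\Bbbk\,\mathcal{PC}_n$ into a direct product of connected algebras is $$\Bbbk\,\mathcal{PC}_n\simeq\Bbbk\times\Bbbk_0\,\mathcal{PC}_n .$$
   Context: $\mathcal{PC}_n$ (the partial Catalan monoid) is the monoid of all partial functions $f$ on $\{1,\dots,n\}$ that are order-preserving ($x\le y\Rightarrow f(x)\le f(y)$ for $x,y$ in the domain) and order-decreasing ($f(x)\le x$ for $x$ in the domain); its zero element is the empty function. $\Bbbk M$ denotes the monoid algebra of a monoid $M$; if $M$ has a zero element $0$, then $\Bbbk_0M=\Bbbk M/\Bbbk\{0\}$, where $\Bbbk\{0\}$ is the ideal spanned by the zero element of $M$. An algebra is connected if $0$ and $1$ are its only central idempotents. *)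

theory Defs
  imports "HOL-Algebra.Algebra"
begin

section \<open>Associative unital algebras\<close>

text \<open>The \<^locale>\<open>algebra\<close> locale of HOL-Algebra only covers commutative algebras, so here
  an algebra over a field is carried by the record \<^typ>\<open>('a, 'b) module\<close>, whose
  multiplication need not commute.\<close>

definition alg_iso ::
  "('k, 'x) ring_scheme \<Rightarrow> ('k, 'a, 'y) module_scheme \<Rightarrow> ('k, 'b, 'z) module_scheme \<Rightarrow> ('a \<Rightarrow> 'b) set"
  where "alg_iso K A B = {h \<in> ring_iso A B.
    \<forall>c\<in>carrier K. \<forall>x\<in>carrier A. h (c \<odot>\<^bsub>A\<^esub> x) = c \<odot>\<^bsub>B\<^esub> h x}"

definition is_alg_iso ::
  "('k, 'x) ring_scheme \<Rightarrow> ('k, 'a, 'y) module_scheme \<Rightarrow> ('k, 'b, 'z) module_scheme \<Rightarrow> bool"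
  where "is_alg_iso K A B \<longleftrightarrow> alg_iso K A B \<noteq> {}"

definition central_idempotents :: "('a, 'y) ring_scheme \<Rightarrow> 'a set"
  where "central_idempotents A = {e \<in> carrier A.
    e \<otimes>\<^bsub>A\<^esub> e = e \<and> (\<forall>x\<in>carrier A. e \<otimes>\<^bsub>A\<^esub> x = x \<otimes>\<^bsub>A\<^esub> e)}"

text \<open>As usual for factors of a direct product decomposition, the zero algebra is not
  connected.\<close>

definition connected_algebra :: "('a, 'y) ring_scheme \<Rightarrow> bool"
  where "connected_algebra A \<longleftrightarrow>
    \<zero>\<^bsub>A\<^esub> \<noteq> \<one>\<^bsub>A\<^esub> \<and> central_idempotents A = {\<zero>\<^bsub>A\<^esub>, \<one>\<^bsub>A\<^esub>}"

definition base_algebra :: "('k, 'x) ring_scheme \<Rightarrow> ('k, 'k) module"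
  where "base_algebra K = \<lparr>carrier = carrier K, monoid.mult = (\<otimes>\<^bsub>K\<^esub>), one = \<one>\<^bsub>K\<^esub>,
    ring.zero = \<zero>\<^bsub>K\<^esub>, add = (\<oplus>\<^bsub>K\<^esub>), module.smult = (\<otimes>\<^bsub>K\<^esub>)\<rparr>"

definition prod_algebra ::
  "('k, 'a, 'y) module_scheme \<Rightarrow> ('k, 'b, 'z) module_scheme \<Rightarrow> ('k, 'a \<times> 'b) module"
  where "prod_algebra A B = ring.extend (RDirProd A B)
    (module.fields (\<lambda>c (x, y). (c \<odot>\<^bsub>A\<^esub> x, c \<odot>\<^bsub>B\<^esub> y)))"

definition quot_algebra :: "('k, 'a, 'y) module_scheme \<Rightarrow> 'a set \<Rightarrow> ('k, 'a set) module"
  where "quot_algebra A I = ring.extend (A Quot I)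
    (module.fields (\<lambda>c S. \<Union>x\<in>S. I +>\<^bsub>A\<^esub> (c \<odot>\<^bsub>A\<^esub> x)))"


section \<open>Monoid algebras\<close>

definition msupp :: "('k, 'x) ring_scheme \<Rightarrow> ('m \<Rightarrow> 'k) \<Rightarrow> 'm set"
  where "msupp K f = {m. f m \<noteq> \<zero>\<^bsub>K\<^esub>}"

text \<open>Formal linear combinations of elements of \<open>M\<close> are functions of finite support, which are
  zero outside the carrier of \<open>M\<close>; the multiplication is convolution.\<close>

definition monoid_algebra ::
  "('k, 'x) ring_scheme \<Rightarrow> ('m, 'y) monoid_scheme \<Rightarrow> ('k, 'm \<Rightarrow> 'k) module"
  where "monoid_algebra K M =
    \<lparr>carrier = {f. range f \<subseteq> carrier K \<and> msupp K f \<subseteq> carrier M \<and> finite (msupp K f)},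
     monoid.mult = (\<lambda>f g m. \<Oplus>\<^bsub>K\<^esub>p\<in>{p \<in> msupp K f \<times> msupp K g. fst p \<otimes>\<^bsub>M\<^esub> snd p = m}.
               f (fst p) \<otimes>\<^bsub>K\<^esub> g (snd p)),
     one = (\<lambda>m. if m = \<one>\<^bsub>M\<^esub> then \<one>\<^bsub>K\<^esub> else \<zero>\<^bsub>K\<^esub>),
     ring.zero = (\<lambda>m. \<zero>\<^bsub>K\<^esub>),
     add = (\<lambda>f g m. f m \<oplus>\<^bsub>K\<^esub> g m),
     module.smult = (\<lambda>c f m. c \<otimes>\<^bsub>K\<^esub> f m)\<rparr>"

definition is_monoid_zero :: "('m, 'y) monoid_scheme \<Rightarrow> 'm \<Rightarrow> bool"
  where "is_monoid_zero M z \<longleftrightarrow> z \<in> carrier M \<and>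
    (\<forall>x\<in>carrier M. z \<otimes>\<^bsub>M\<^esub> x = z \<and> x \<otimes>\<^bsub>M\<^esub> z = z)"

text \<open>The linear span of the basis element \<open>z\<close>; an ideal if \<open>z\<close> is the zero of \<open>M\<close>.\<close>

definition basis_span ::
  "('k, 'x) ring_scheme \<Rightarrow> ('m, 'y) monoid_scheme \<Rightarrow> 'm \<Rightarrow> ('m \<Rightarrow> 'k) set"
  where "basis_span K M z =
    {c \<odot>\<^bsub>monoid_algebra K M\<^esub> (\<lambda>m. if m = z then \<one>\<^bsub>K\<^esub> else \<zero>\<^bsub>K\<^esub>) | c. c \<in> carrier K}"

text \<open>To be used only if \<open>z\<close> is the zero of \<open>M\<close>.\<close>

definition contracted_algebra ::
  "('k, 'x) ring_scheme \<Rightarrow> ('m, 'y) monoid_scheme \<Rightarrow> 'm \<Rightarrow> ('k, ('m \<Rightarrow> 'k) set) module"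
  where "contracted_algebra K M z = quot_algebra (monoid_algebra K M) (basis_span K M z)"


section \<open>The partial Catalan monoid\<close>

text \<open>Composition is from right to left.\<close>

definition PC :: "nat \<Rightarrow> (nat \<rightharpoonup> nat) monoid"
  where "PC n =
    \<lparr>carrier = {f. dom f \<subseteq> {1..n} \<and> ran f \<subseteq> {1..n} \<and>
       (\<forall>x\<in>dom f. \<forall>y\<in>dom f. x \<le> y \<longrightarrow> the (f x) \<le> the (f y)) \<and>
       (\<forall>x\<in>dom f. the (f x) \<le> x)},
     monoid.mult = (\<circ>\<^sub>m),
     one = Some |` {1..n}\<rparr>"

lemma PC_monoid: "Group.monoid (PC n)"
proof (rule Group.monoidI)
  fix f g assume f: "f \<in> carrier (PC n)" and g: "g \<in> carrier (PC n)"
  have fD: "x \<in> {1..n} \<and> a \<in> {1..n} \<and> a \<le> x" if "f x = Some a" for x a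
    using f that by (force simp: PC_def dom_def ran_def)
  have gD: "x \<in> {1..n} \<and> a \<in> {1..n} \<and> a \<le> x" if "g x = Some a" for x a
    using g that by (force simp: PC_def dom_def ran_def)
  have fM: "a \<le> b" if "f x = Some a" "f y = Some b" "x \<le> y" for x y a b
    using f that by (force simp: PC_def dom_def)
  have gM: "a \<le> b" if "g x = Some a" "g y = Some b" "x \<le> y" for x y a b
    using g that by (force simp: PC_def dom_def)
  show "f \<otimes>\<^bsub>PC n\<^esub> g \<in> carrier (PC n)"
    unfolding PC_def
  proof (simp, intro conjI ballI impI)
    show "dom (f \<circ>\<^sub>m g) \<subseteq> {Suc 0..n}"
      using gD by (fastforce simp: dom_def map_comp_def split: option.splits)
    show "ran (f \<circ>\<^sub>m g) \<subseteq> {Suc 0..n}"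
      using fD by (fastforce simp: ran_def map_comp_def split: option.splits)
  next
    fix x y assume "x \<in> dom (f \<circ>\<^sub>m g)" "y \<in> dom (f \<circ>\<^sub>m g)" "x \<le> y"
    then show "the ((f \<circ>\<^sub>m g) x) \<le> the ((f \<circ>\<^sub>m g) y)"
      by (auto simp: map_comp_Some_iff) (meson fM gM)
  next
    fix x assume "x \<in> dom (f \<circ>\<^sub>m g)"
    then show "the ((f \<circ>\<^sub>m g) x) \<le> x"
      by (auto simp: map_comp_Some_iff) (meson fD gD order_trans)
  qed
next
  show "\<one>\<^bsub>PC n\<^esub> \<in> carrier (PC n)"
    by (auto simp: PC_def ran_def restrict_map_def split: if_splits)
next
  fix f g h show "f \<otimes>\<^bsub>PC n\<^esub> g \<otimes>\<^bsub>PC n\<^esub> h = f \<otimes>\<^bsub>PC n\<^esub> (g \<otimes>\<^bsub>PC n\<^esub> h)"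
    by (auto simp: PC_def map_comp_def split: option.splits)
next
  fix f assume f: "f \<in> carrier (PC n)"
  show "\<one>\<^bsub>PC n\<^esub> \<otimes>\<^bsub>PC n\<^esub> f = f"
  proof
    fix x
    have "f x = Some a \<Longrightarrow> a \<in> {1..n}" for a
      using f by (auto simp: PC_def ran_def)
    then show "(\<one>\<^bsub>PC n\<^esub> \<otimes>\<^bsub>PC n\<^esub> f) x = f x"
      by (cases "f x") (auto simp: PC_def map_comp_def restrict_map_def)
  qed
  show "f \<otimes>\<^bsub>PC n\<^esub> \<one>\<^bsub>PC n\<^esub> = f"
  proof
    fix x
    have "x \<notin> {1..n} \<Longrightarrow> f x = None"
      using f by (auto simp: PC_def dom_def)
    then show "(f \<otimes>\<^bsub>PC n\<^esub> \<one>\<^bsub>PC n\<^esub>) x = f x"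
      by (auto simp: PC_def map_comp_def restrict_map_def)
  qed
qed

lemma PC_zero: "is_monoid_zero (PC n) Map.empty"
  by (auto simp: is_monoid_zero_def PC_def map_comp_def)

end

theory Submission
  imports Defs
begin

text \<open>For a monoid with zero \<open>z\<close>, the basis element \<open>z\<close> is a central idempotent which spans an
  ideal isomorphic to the field, so it splits off through the augmentation.

  That the contracted algebra is connected follows from the stronger fact that its center
  consists of scalars. For a nonempty partial function \<open>m\<close> let \<open>F f m\<close> be the sum of the
  coefficients of \<open>f\<close> at all extensions of \<open>m\<close>; by Moebius inversion \<open>F f\<close> determines \<open>f\<close> modulo
  the zero. (In these coordinates the algebra is that of the category of order-preserving and
  decreasing surjections between nonempty subsets, all of whose endomorphisms are identities.)
  If \<open>f\<close> is central, then commuting with the partial identity on the image of \<open>m\<close> gives \<open>F f m = 0\<close>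
  unless \<open>m\<close> is a partial identity, and commuting with the constant map \<open>1\<close> on a set \<open>B\<close> shows that
  \<open>F f\<close> has the same value at the identity of \<open>B\<close> and at the identity of \<open>{1}\<close>.\<close>

section \<open>Monoid algebras as rings\<close>

text \<open>Used in two roles: as an element of the algebra, and as the functional that reads off
  one coefficient.\<close>

definition basis_elt :: "('k, 'x) ring_scheme \<Rightarrow> 'm \<Rightarrow> 'm \<Rightarrow> 'k"
  where "basis_elt K m = (\<lambda>x. if x = m then \<one>\<^bsub>K\<^esub> else \<zero>\<^bsub>K\<^esub>)"

text \<open>The linear functional with value \<open>\<phi> m\<close> at the basis element
  \<open>m\<close>, applied to \<open>f\<close>. Identities in the algebra are tested on such
  functionals, and \<open>lin_ext_mult\<close> then replaces the unfolding of convolution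
  sums.\<close>

definition lin_ext :: "('k, 'x) ring_scheme \<Rightarrow> ('m \<Rightarrow> 'k) \<Rightarrow> ('m \<Rightarrow> 'k) \<Rightarrow> 'k"
  where "lin_ext K \<phi> f = (\<Oplus>\<^bsub>K\<^esub>m\<in>msupp K f. f m \<otimes>\<^bsub>K\<^esub> \<phi> m)"

locale monoid_ring = K: cring K + M: Group.monoid M
  for K :: "('k, 'x) ring_scheme" and M :: "('m, 'y) monoid_scheme"
begin

abbreviation A :: "('k, 'm \<Rightarrow> 'k) module"
  where "A \<equiv> monoid_algebra K M"

section \<open>Module structure of the monoid algebra\<close>

lemma carrier_iff:
  "f \<in> carrier A \<longleftrightarrow>
     (\<forall>m. f m \<in> carrier K) \<and> (\<forall>m. m \<notin> carrier M \<longrightarrow> f m = \<zero>\<^bsub>K\<^esub>) \<and> finite (msupp K f)"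
  by (auto simp: monoid_algebra_def msupp_def)

lemma coeff_closed [simp]: "f \<in> carrier A \<Longrightarrow> f m \<in> carrier K"
  by (simp add: carrier_iff)

lemma coeff_outside: "f \<in> carrier A \<Longrightarrow> m \<notin> carrier M \<Longrightarrow> f m = \<zero>\<^bsub>K\<^esub>"
  by (simp add: carrier_iff)

lemma finite_msupp: "f \<in> carrier A \<Longrightarrow> finite (msupp K f)"
  by (simp add: carrier_iff)

lemma msupp_subset: "f \<in> carrier A \<Longrightarrow> msupp K f \<subseteq> carrier M"
  by (auto simp: carrier_iff msupp_def)

lemma mem_msupp_carrier: "m \<in> msupp K f \<Longrightarrow> f \<in> carrier A \<Longrightarrow> m \<in> carrier M"
  using msupp_subset by blast

lemma carrierI:
  assumes "\<And>m. f m \<in> carrier K" "finite B" "B \<subseteq> carrier M" "\<And>m. m \<notin> B \<Longrightarrow> f m = \<zero>\<^bsub>K\<^esub>"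
  shows "f \<in> carrier A"
proof -
  have "msupp K f \<subseteq> B"
    using assms(4) by (auto simp: msupp_def)
  then show ?thesis
    using assms by (auto simp: carrier_iff intro: finite_subset)
qed

lemma add_apply: "(f \<oplus>\<^bsub>A\<^esub> g) m = f m \<oplus>\<^bsub>K\<^esub> g m"
  and smult_apply: "(c \<odot>\<^bsub>A\<^esub> f) m = c \<otimes>\<^bsub>K\<^esub> f m"
  and zero_apply: "\<zero>\<^bsub>A\<^esub> m = \<zero>\<^bsub>K\<^esub>"
  and one_eq: "\<one>\<^bsub>A\<^esub> = basis_elt K \<one>\<^bsub>M\<^esub>"
  by (simp_all add: monoid_algebra_def basis_elt_def)

lemma basis_closed [simp]: "m \<in> carrier M \<Longrightarrow> basis_elt K m \<in> carrier A"
  by (rule carrierI[where B = "{m}"]) (auto simp: basis_elt_def)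

lemma one_closed [simp]: "\<one>\<^bsub>A\<^esub> \<in> carrier A"
  by (simp add: one_eq)

lemma zero_closed [simp]: "\<zero>\<^bsub>A\<^esub> \<in> carrier A"
  by (rule carrierI[where B = "{}"]) (auto simp: zero_apply)

lemma add_closed [simp]: "f \<in> carrier A \<Longrightarrow> g \<in> carrier A \<Longrightarrow> f \<oplus>\<^bsub>A\<^esub> g \<in> carrier A"
  by (rule carrierI[where B = "msupp K f \<union> msupp K g"])
    (auto simp: add_apply finite_msupp mem_msupp_carrier, simp add: msupp_def)

lemma smult_closed [simp]: "c \<in> carrier K \<Longrightarrow> f \<in> carrier A \<Longrightarrow> c \<odot>\<^bsub>A\<^esub> f \<in> carrier A"
  by (rule carrierI[where B = "msupp K f"])
    (auto simp: smult_apply finite_msupp mem_msupp_carrier, simp add: msupp_def)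

section \<open>Linear functionals given by their values on the basis\<close>

lemma lin_ext_superset:
  assumes "f \<in> carrier A" "finite B" "msupp K f \<subseteq> B" "\<And>m. m \<in> B \<Longrightarrow> \<phi> m \<in> carrier K"
  shows "lin_ext K \<phi> f = (\<Oplus>\<^bsub>K\<^esub>m\<in>B. f m \<otimes>\<^bsub>K\<^esub> \<phi> m)"
  unfolding lin_ext_def
  by (rule K.add.finprod_mono_neutral_cong_left) (use assms in \<open>auto simp: msupp_def\<close>)

lemma lin_ext_closed [simp]:
  assumes "f \<in> carrier A" "\<And>m. m \<in> carrier M \<Longrightarrow> \<phi> m \<in> carrier K"
  shows "lin_ext K \<phi> f \<in> carrier K"
  unfolding lin_ext_def
  by (rule K.finsum_closed) (use assms in \<open>auto simp: mem_msupp_carrier\<close>)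

lemma lin_ext_cong:
  assumes "f \<in> carrier A" "\<And>m. m \<in> msupp K f \<Longrightarrow> \<phi> m = \<psi> m"
    "\<And>m. m \<in> carrier M \<Longrightarrow> \<psi> m \<in> carrier K"
  shows "lin_ext K \<phi> f = lin_ext K \<psi> f"
  unfolding lin_ext_def
  by (rule K.finsum_cong') (use assms in \<open>auto simp: mem_msupp_carrier\<close>)

lemma lin_ext_add:
  assumes "f \<in> carrier A" "g \<in> carrier A" "\<And>m. m \<in> carrier M \<Longrightarrow> \<phi> m \<in> carrier K"
  shows "lin_ext K \<phi> (f \<oplus>\<^bsub>A\<^esub> g) = lin_ext K \<phi> f \<oplus>\<^bsub>K\<^esub> lin_ext K \<phi> g"
proof -
  let ?B = "msupp K f \<union> msupp K g"
  have B: "finite ?B" "\<And>m. m \<in> ?B \<Longrightarrow> \<phi> m \<in> carrier K"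
    using assms msupp_subset by (auto simp: finite_msupp)
  have sub: "msupp K (f \<oplus>\<^bsub>A\<^esub> g) \<subseteq> ?B"
    by (auto simp: msupp_def add_apply)
  have "lin_ext K \<phi> (f \<oplus>\<^bsub>A\<^esub> g) = (\<Oplus>\<^bsub>K\<^esub>m\<in>?B. (f \<oplus>\<^bsub>A\<^esub> g) m \<otimes>\<^bsub>K\<^esub> \<phi> m)"
    by (rule lin_ext_superset) (use assms B sub in auto)
  also have "\<dots> = (\<Oplus>\<^bsub>K\<^esub>m\<in>?B. f m \<otimes>\<^bsub>K\<^esub> \<phi> m \<oplus>\<^bsub>K\<^esub> g m \<otimes>\<^bsub>K\<^esub> \<phi> m)"
    by (rule K.finsum_cong') (use assms B in \<open>auto simp: add_apply K.l_distr\<close>)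
  also have "\<dots> = (\<Oplus>\<^bsub>K\<^esub>m\<in>?B. f m \<otimes>\<^bsub>K\<^esub> \<phi> m) \<oplus>\<^bsub>K\<^esub> (\<Oplus>\<^bsub>K\<^esub>m\<in>?B. g m \<otimes>\<^bsub>K\<^esub> \<phi> m)"
    by (rule K.finsum_addf) (use assms B in auto)
  also have "(\<Oplus>\<^bsub>K\<^esub>m\<in>?B. f m \<otimes>\<^bsub>K\<^esub> \<phi> m) = lin_ext K \<phi> f"
    by (rule lin_ext_superset[symmetric]) (use assms B in auto)
  also have "(\<Oplus>\<^bsub>K\<^esub>m\<in>?B. g m \<otimes>\<^bsub>K\<^esub> \<phi> m) = lin_ext K \<phi> g"
    by (rule lin_ext_superset[symmetric]) (use assms B in auto)
  finally show ?thesis .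
qed

lemma lin_ext_smult:
  assumes "c \<in> carrier K" "f \<in> carrier A" "\<And>m. m \<in> carrier M \<Longrightarrow> \<phi> m \<in> carrier K"
  shows "lin_ext K \<phi> (c \<odot>\<^bsub>A\<^esub> f) = c \<otimes>\<^bsub>K\<^esub> lin_ext K \<phi> f"
proof -
  have B: "finite (msupp K f)" "\<And>m. m \<in> msupp K f \<Longrightarrow> \<phi> m \<in> carrier K"
    using assms msupp_subset by (auto simp: finite_msupp)
  have sub: "msupp K (c \<odot>\<^bsub>A\<^esub> f) \<subseteq> msupp K f"
    using assms by (auto simp: msupp_def smult_apply)
  have "lin_ext K \<phi> (c \<odot>\<^bsub>A\<^esub> f) = (\<Oplus>\<^bsub>K\<^esub>m\<in>msupp K f. (c \<odot>\<^bsub>A\<^esub> f) m \<otimes>\<^bsub>K\<^esub> \<phi> m)"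
    by (rule lin_ext_superset) (use assms B sub in auto)
  also have "\<dots> = (\<Oplus>\<^bsub>K\<^esub>m\<in>msupp K f. c \<otimes>\<^bsub>K\<^esub> (f m \<otimes>\<^bsub>K\<^esub> \<phi> m))"
    by (rule K.finsum_cong') (use assms B in \<open>auto simp: smult_apply K.m_assoc\<close>)
  also have "\<dots> = c \<otimes>\<^bsub>K\<^esub> lin_ext K \<phi> f"
    unfolding lin_ext_def
    by (rule K.finsum_rdistr[symmetric]) (use assms B in auto)
  finally show ?thesis .
qed

lemma lin_ext_add_fun:
  assumes "f \<in> carrier A" "\<And>m. m \<in> carrier M \<Longrightarrow> \<phi> m \<in> carrier K"
    "\<And>m. m \<in> carrier M \<Longrightarrow> \<psi> m \<in> carrier K"
  shows "lin_ext K (\<lambda>m. \<phi> m \<oplus>\<^bsub>K\<^esub> \<psi> m) f = lin_ext K \<phi> f \<oplus>\<^bsub>K\<^esub> lin_ext K \<psi> f"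
proof -
  have B: "\<And>m. m \<in> msupp K f \<Longrightarrow> m \<in> carrier M"
    using assms(1) msupp_subset by auto
  have "lin_ext K (\<lambda>m. \<phi> m \<oplus>\<^bsub>K\<^esub> \<psi> m) f =
      (\<Oplus>\<^bsub>K\<^esub>m\<in>msupp K f. f m \<otimes>\<^bsub>K\<^esub> \<phi> m \<oplus>\<^bsub>K\<^esub> f m \<otimes>\<^bsub>K\<^esub> \<psi> m)"
    unfolding lin_ext_def
    by (rule K.finsum_cong') (use assms B in \<open>auto simp: K.r_distr\<close>)
  also have "\<dots> = lin_ext K \<phi> f \<oplus>\<^bsub>K\<^esub> lin_ext K \<psi> f"
    unfolding lin_ext_def by (rule K.finsum_addf) (use assms B in auto)
  finally show ?thesis .
qed

lemma lin_ext_zero_fun: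
  "f \<in> carrier A \<Longrightarrow> lin_ext K (\<lambda>_. \<zero>\<^bsub>K\<^esub>) f = \<zero>\<^bsub>K\<^esub>"
  unfolding lin_ext_def by (rule K.add.finprod_one_eqI) simp

lemma lin_ext_basis:
  assumes "m \<in> carrier M" "\<phi> m \<in> carrier K"
  shows "lin_ext K \<phi> (basis_elt K m) = \<phi> m"
proof -
  have "lin_ext K \<phi> (basis_elt K m) = (\<Oplus>\<^bsub>K\<^esub>x\<in>{m}. basis_elt K m x \<otimes>\<^bsub>K\<^esub> \<phi> x)"
    by (rule lin_ext_superset) (use assms in \<open>auto simp: msupp_def basis_elt_def basis_closed[unfolded basis_elt_def]\<close>)
  also have "\<dots> = \<phi> m"
    using assms by (subst K.finsum_insert) (auto simp: basis_elt_def)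
  finally show ?thesis .
qed

lemma coeff_eq_lin_ext:
  assumes "f \<in> carrier A" "m \<in> carrier M"
  shows "f m = lin_ext K (basis_elt K m) f"
proof -
  \<comment> \<open>The point \<open>m\<close> is inserted because it may lie outside the support of
    \<open>f\<close>.\<close>
  have "lin_ext K (basis_elt K m) f = (\<Oplus>\<^bsub>K\<^esub>x\<in>insert m (msupp K f). f x \<otimes>\<^bsub>K\<^esub> basis_elt K m x)"
    by (rule lin_ext_superset) (use assms in \<open>auto simp: finite_msupp basis_elt_def\<close>)
  also have "\<dots> = (\<Oplus>\<^bsub>K\<^esub>x\<in>{m}. f x)"
    by (rule K.add.finprod_mono_neutral_cong_right)
      (use assms in \<open>auto simp: finite_msupp basis_elt_def\<close>)
  also have "\<dots> = f m"
    using assms by simp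
  finally show ?thesis by simp
qed

text \<open>Functionals separate elements, because the coefficient functionals are among them. This
  reduces the multiplicative ring axioms to identities between nested functionals.\<close>

lemma alg_eqI:
  assumes "f \<in> carrier A" "g \<in> carrier A"
    and "\<And>\<phi>. (\<And>m. \<phi> m \<in> carrier K) \<Longrightarrow> lin_ext K \<phi> f = lin_ext K \<phi> g"
  shows "f = g"
proof
  fix m :: 'm
  have "\<And>x. basis_elt K m x \<in> carrier K"
    by (simp add: basis_elt_def)
  then have "lin_ext K (basis_elt K m) f = lin_ext K (basis_elt K m) g"
    by (rule assms(3))
  then show "f m = g m"
    using assms(1,2) by (cases "m \<in> carrier M") (simp_all add: coeff_eq_lin_ext coeff_outside)
qed

section \<open>Convolution and the ring axioms\<close>

lemma mult_apply:
  "(f \<otimes>\<^bsub>A\<^esub> g) m = (\<Oplus>\<^bsub>K\<^esub>p\<in>{p \<in> msupp K f \<times> msupp K g. fst p \<otimes>\<^bsub>M\<^esub> snd p = m}.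
     f (fst p) \<otimes>\<^bsub>K\<^esub> g (snd p))"
  by (simp add: monoid_algebra_def)

lemma mult_apply_outside:
  assumes "m \<notin> (\<lambda>p. fst p \<otimes>\<^bsub>M\<^esub> snd p) ` (msupp K f \<times> msupp K g)"
  shows "(f \<otimes>\<^bsub>A\<^esub> g) m = \<zero>\<^bsub>K\<^esub>"
proof -
  have "{p \<in> msupp K f \<times> msupp K g. fst p \<otimes>\<^bsub>M\<^esub> snd p = m} = {}"
    using assms by blast
  then show ?thesis
    unfolding mult_apply by (simp only: K.finsum_empty)
qed

lemma mult_closed [simp]:
  assumes f: "f \<in> carrier A" and g: "g \<in> carrier A"
  shows "f \<otimes>\<^bsub>A\<^esub> g \<in> carrier A"
proof (rule carrierI[where B = "(\<lambda>p. fst p \<otimes>\<^bsub>M\<^esub> snd p) ` (msupp K f \<times> msupp K g)"])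
  show "(f \<otimes>\<^bsub>A\<^esub> g) m \<in> carrier K" for m
    unfolding mult_apply by (rule K.finsum_closed) (use f g in auto)
qed (use f g msupp_subset in \<open>auto simp: finite_msupp mult_apply_outside\<close>, meson M.m_closed subsetD)

text \<open>Both sides are the sum of \<open>f a\<close>, \<open>g b\<close> and
  \<open>\<phi>\<close> of the product of \<open>a\<close> and \<open>b\<close>, multiplied
  together, over all pairs of support elements. The left side groups the pairs by their product, the
  right side by their first entry.\<close>

lemma lin_ext_mult:
  assumes f: "f \<in> carrier A" and g: "g \<in> carrier A"
    and \<phi>: "\<And>m. m \<in> carrier M \<Longrightarrow> \<phi> m \<in> carrier K"
  shows "lin_ext K \<phi> (f \<otimes>\<^bsub>A\<^esub> g) = lin_ext K (\<lambda>a. lin_ext K (\<lambda>b. \<phi> (a \<otimes>\<^bsub>M\<^esub> b)) g) f"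
proof -
  let ?P = "msupp K f \<times> msupp K g"
  let ?mul = "\<lambda>p. fst p \<otimes>\<^bsub>M\<^esub> snd p"
  let ?F = "\<lambda>m. {p \<in> ?P. ?mul p = m}"
  let ?t = "\<lambda>p. f (fst p) \<otimes>\<^bsub>K\<^esub> g (snd p) \<otimes>\<^bsub>K\<^esub> \<phi> (?mul p)"
  have P: "finite ?P" "\<And>m. finite (?F m)"
    using f g by (auto simp: finite_msupp)
  have mulM: "?mul p \<in> carrier M" if "p \<in> ?P" for p
    using that f g msupp_subset by (metis M.m_closed mem_Times_iff subsetD)
  have t: "?t p \<in> carrier K" if "p \<in> ?P" for p
    using that f g \<phi>[OF mulM] by auto
  have "lin_ext K \<phi> (f \<otimes>\<^bsub>A\<^esub> g) = (\<Oplus>\<^bsub>K\<^esub>m\<in>?mul ` ?P. (f \<otimes>\<^bsub>A\<^esub> g) m \<otimes>\<^bsub>K\<^esub> \<phi> m)"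
  proof (rule lin_ext_superset)
    show "msupp K (f \<otimes>\<^bsub>A\<^esub> g) \<subseteq> ?mul ` ?P"
      using mult_apply_outside unfolding msupp_def by blast
  qed (use f g P mulM \<phi> in auto)
  \<comment> \<open>Each coefficient of the product is a sum over the fibre \<open>?F m\<close> of
    the multiplication map, on which \<open>\<phi> m\<close> is \<open>\<phi>\<close> of the product
    of the pair.\<close>
  also have "\<dots> = (\<Oplus>\<^bsub>K\<^esub>m\<in>?mul ` ?P. \<Oplus>\<^bsub>K\<^esub>p\<in>?F m. ?t p)"
  proof (rule K.finsum_cong')
    show "(\<lambda>m. \<Oplus>\<^bsub>K\<^esub>p\<in>?F m. ?t p) \<in> ?mul ` ?P \<rightarrow> carrier K"
      using t by (intro Pi_I K.finsum_closed) auto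
    fix m assume "m \<in> ?mul ` ?P"
    then have "\<phi> m \<in> carrier K"
      using mulM \<phi> by auto
    then have "(f \<otimes>\<^bsub>A\<^esub> g) m \<otimes>\<^bsub>K\<^esub> \<phi> m =
        (\<Oplus>\<^bsub>K\<^esub>p\<in>?F m. f (fst p) \<otimes>\<^bsub>K\<^esub> g (snd p) \<otimes>\<^bsub>K\<^esub> \<phi> m)"
      unfolding mult_apply using f g P by (intro K.finsum_ldistr) auto
    also have "\<dots> = (\<Oplus>\<^bsub>K\<^esub>p\<in>?F m. ?t p)"
      by (rule K.finsum_cong') (use t in auto)
    finally show "(f \<otimes>\<^bsub>A\<^esub> g) m \<otimes>\<^bsub>K\<^esub> \<phi> m = (\<Oplus>\<^bsub>K\<^esub>p\<in>?F m. ?t p)" .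
  qed simp
  also have "\<dots> = (\<Oplus>\<^bsub>K\<^esub>p\<in>\<Union> (?F ` ?mul ` ?P). ?t p)"
    by (rule K.add.finprod_UN_disjoint[symmetric])
      (use P t in \<open>auto simp: pairwise_def disjnt_def\<close>)
  \<comment> \<open>The fibres partition all of \<open>?P\<close>, which is now cut into rows with
    constant first entry instead.\<close>
  also have "\<Union> (?F ` ?mul ` ?P) = \<Union> ((\<lambda>a. Pair a ` msupp K g) ` msupp K f)"
    by auto
  also have "(\<Oplus>\<^bsub>K\<^esub>p\<in>\<dots>. ?t p) = (\<Oplus>\<^bsub>K\<^esub>a\<in>msupp K f. \<Oplus>\<^bsub>K\<^esub>p\<in>Pair a ` msupp K g. ?t p)"
    by (rule K.add.finprod_UN_disjoint)
      (use f g t in \<open>auto simp: pairwise_def disjnt_def finite_msupp\<close>)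
  also have "\<dots> = lin_ext K (\<lambda>a. lin_ext K (\<lambda>b. \<phi> (a \<otimes>\<^bsub>M\<^esub> b)) g) f"
    unfolding lin_ext_def[of _ _ f]
  proof (rule K.finsum_cong')
    have lin: "lin_ext K (\<lambda>b. \<phi> (a \<otimes>\<^bsub>M\<^esub> b)) g \<in> carrier K" if "a \<in> msupp K f" for a
      using that f g \<phi> by (intro lin_ext_closed) (auto simp: mem_msupp_carrier)
    then show "(\<lambda>a. f a \<otimes>\<^bsub>K\<^esub> lin_ext K (\<lambda>b. \<phi> (a \<otimes>\<^bsub>M\<^esub> b)) g) \<in> msupp K f \<rightarrow> carrier K"
      using f by auto
    fix a assume a: "a \<in> msupp K f"
    have \<phi>ab: "\<phi> (a \<otimes>\<^bsub>M\<^esub> b) \<in> carrier K" if "b \<in> msupp K g" for b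
      using \<phi>[OF mulM[of "(a, b)"]] a that by simp
    have "(\<Oplus>\<^bsub>K\<^esub>p\<in>Pair a ` msupp K g. ?t p) = (\<Oplus>\<^bsub>K\<^esub>b\<in>msupp K g. ?t (a, b))"
      by (rule K.finsum_reindex) (use t a in \<open>auto simp: inj_on_def\<close>)
    also have "\<dots> = (\<Oplus>\<^bsub>K\<^esub>b\<in>msupp K g. f a \<otimes>\<^bsub>K\<^esub> (g b \<otimes>\<^bsub>K\<^esub> \<phi> (a \<otimes>\<^bsub>M\<^esub> b)))"
      by (rule K.finsum_cong') (use f g \<phi>ab in \<open>auto simp: K.m_assoc\<close>)
    also have "\<dots> = f a \<otimes>\<^bsub>K\<^esub> lin_ext K (\<lambda>b. \<phi> (a \<otimes>\<^bsub>M\<^esub> b)) g"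
      unfolding lin_ext_def
      by (rule K.finsum_rdistr[symmetric]) (use f g \<phi>ab in \<open>auto simp: finite_msupp\<close>)
    finally show "(\<Oplus>\<^bsub>K\<^esub>p\<in>Pair a ` msupp K g. ?t p) =
        f a \<otimes>\<^bsub>K\<^esub> lin_ext K (\<lambda>b. \<phi> (a \<otimes>\<^bsub>M\<^esub> b)) g" .
  qed simp
  finally show ?thesis .
qed

lemma ring_A: "ring A"
proof (rule ringI)
  show "abelian_group A"
  proof (rule abelian_groupI)
    fix f assume f: "f \<in> carrier A"
    let ?h = "\<lambda>m. \<ominus>\<^bsub>K\<^esub> f m"
    have "?h \<in> carrier A"
      by (rule carrierI[where B = "msupp K f"])
        (use f in \<open>auto simp: finite_msupp mem_msupp_carrier\<close>, simp add: msupp_def)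
    moreover have "?h \<oplus>\<^bsub>A\<^esub> f = \<zero>\<^bsub>A\<^esub>"
      using f by (auto simp: fun_eq_iff add_apply zero_apply K.l_neg)
    ultimately show "\<exists>h\<in>carrier A. h \<oplus>\<^bsub>A\<^esub> f = \<zero>\<^bsub>A\<^esub>" by blast
  qed (auto simp: fun_eq_iff add_apply zero_apply K.a_ac)
  show "Group.monoid A"
  proof (rule Group.monoidI)
    fix f g h assume fgh: "f \<in> carrier A" "g \<in> carrier A" "h \<in> carrier A"
    show "f \<otimes>\<^bsub>A\<^esub> g \<otimes>\<^bsub>A\<^esub> h = f \<otimes>\<^bsub>A\<^esub> (g \<otimes>\<^bsub>A\<^esub> h)"
    proof (rule alg_eqI)
      fix \<phi> :: "'m \<Rightarrow> 'k" assume \<phi>: "\<And>m. \<phi> m \<in> carrier K"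
      \<comment> \<open>Both bracketings unfold to a threefold nested functional, where only
        associativity in \<open>M\<close> is left to use.\<close>
      have "lin_ext K \<phi> (f \<otimes>\<^bsub>A\<^esub> g \<otimes>\<^bsub>A\<^esub> h) =
          lin_ext K (\<lambda>a. lin_ext K (\<lambda>b. lin_ext K (\<lambda>c. \<phi> (a \<otimes>\<^bsub>M\<^esub> b \<otimes>\<^bsub>M\<^esub> c)) h) g) f"
        using fgh \<phi> by (simp add: lin_ext_mult)
      also have "\<dots> =
          lin_ext K (\<lambda>a. lin_ext K (\<lambda>b. lin_ext K (\<lambda>c. \<phi> (a \<otimes>\<^bsub>M\<^esub> (b \<otimes>\<^bsub>M\<^esub> c))) h) g) f"
        using fgh \<phi> by (intro lin_ext_cong) (auto simp: M.m_assoc mem_msupp_carrier)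
      also have "\<dots> = lin_ext K \<phi> (f \<otimes>\<^bsub>A\<^esub> (g \<otimes>\<^bsub>A\<^esub> h))"
        using fgh \<phi> by (simp add: lin_ext_mult)
      finally show "lin_ext K \<phi> (f \<otimes>\<^bsub>A\<^esub> g \<otimes>\<^bsub>A\<^esub> h) = lin_ext K \<phi> (f \<otimes>\<^bsub>A\<^esub> (g \<otimes>\<^bsub>A\<^esub> h))" .
    qed (use fgh in auto)
  next
    fix f assume f: "f \<in> carrier A"
    show "\<one>\<^bsub>A\<^esub> \<otimes>\<^bsub>A\<^esub> f = f"
    proof (rule alg_eqI)
      fix \<phi> :: "'m \<Rightarrow> 'k" assume \<phi>: "\<And>m. \<phi> m \<in> carrier K"
      have "lin_ext K \<phi> (\<one>\<^bsub>A\<^esub> \<otimes>\<^bsub>A\<^esub> f) = lin_ext K (\<lambda>b. \<phi> (\<one>\<^bsub>M\<^esub> \<otimes>\<^bsub>M\<^esub> b)) f"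
        using f \<phi> by (simp add: lin_ext_mult) (simp add: one_eq lin_ext_basis)
      also have "\<dots> = lin_ext K \<phi> f"
        using f \<phi> by (intro lin_ext_cong) (auto simp: mem_msupp_carrier)
      finally show "lin_ext K \<phi> (\<one>\<^bsub>A\<^esub> \<otimes>\<^bsub>A\<^esub> f) = lin_ext K \<phi> f" .
    qed (use f in auto)
    show "f \<otimes>\<^bsub>A\<^esub> \<one>\<^bsub>A\<^esub> = f"
    proof (rule alg_eqI)
      fix \<phi> :: "'m \<Rightarrow> 'k" assume \<phi>: "\<And>m. \<phi> m \<in> carrier K"
      have "lin_ext K \<phi> (f \<otimes>\<^bsub>A\<^esub> \<one>\<^bsub>A\<^esub>) = lin_ext K (\<lambda>a. \<phi> (a \<otimes>\<^bsub>M\<^esub> \<one>\<^bsub>M\<^esub>)) f"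
        using f \<phi> by (simp add: lin_ext_mult) (simp add: one_eq lin_ext_basis)
      also have "\<dots> = lin_ext K \<phi> f"
        using f \<phi> by (intro lin_ext_cong) (auto simp: mem_msupp_carrier)
      finally show "lin_ext K \<phi> (f \<otimes>\<^bsub>A\<^esub> \<one>\<^bsub>A\<^esub>) = lin_ext K \<phi> f" .
    qed (use f in auto)
  qed auto
  fix f g h assume fgh: "f \<in> carrier A" "g \<in> carrier A" "h \<in> carrier A"
  show "(f \<oplus>\<^bsub>A\<^esub> g) \<otimes>\<^bsub>A\<^esub> h = f \<otimes>\<^bsub>A\<^esub> h \<oplus>\<^bsub>A\<^esub> g \<otimes>\<^bsub>A\<^esub> h"
    by (rule alg_eqI) (use fgh in \<open>auto simp: lin_ext_mult lin_ext_add\<close>)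
  show "h \<otimes>\<^bsub>A\<^esub> (f \<oplus>\<^bsub>A\<^esub> g) = h \<otimes>\<^bsub>A\<^esub> f \<oplus>\<^bsub>A\<^esub> h \<otimes>\<^bsub>A\<^esub> g"
    by (rule alg_eqI) (use fgh in \<open>auto simp: lin_ext_mult lin_ext_add lin_ext_add_fun\<close>)
qed

end

section \<open>Contracted monoid algebras\<close>

locale monoid_zero_ring = monoid_ring K M
  for K :: "('k, 'x) ring_scheme" and M :: "('m, 'y) monoid_scheme" +
  fixes z :: 'm
  assumes monoid_zero: "is_monoid_zero M z"
begin

sublocale A: ring A
  by (rule ring_A)

abbreviation I :: "('m \<Rightarrow> 'k) set"
  where "I \<equiv> basis_span K M z"

abbreviation Q :: "('k, ('m \<Rightarrow> 'k) set) module"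
  where "Q \<equiv> contracted_algebra K M z"

section \<open>The ideal spanned by the zero element\<close>

lemma z_closed [simp]: "z \<in> carrier M"
  and z_mult [simp]: "x \<in> carrier M \<Longrightarrow> z \<otimes>\<^bsub>M\<^esub> x = z"
  and mult_z [simp]: "x \<in> carrier M \<Longrightarrow> x \<otimes>\<^bsub>M\<^esub> z = z"
  using monoid_zero by (auto simp: is_monoid_zero_def)

lemma uminus_apply: "f \<in> carrier A \<Longrightarrow> (\<ominus>\<^bsub>A\<^esub> f) m = \<ominus>\<^bsub>K\<^esub> f m"
  using fun_cong[OF A.l_neg[of f], of m]
  by (intro K.minus_equality[symmetric]) (auto simp: add_apply zero_apply)

lemma minus_apply:
  "f \<in> carrier A \<Longrightarrow> g \<in> carrier A \<Longrightarrow> (f \<ominus>\<^bsub>A\<^esub> g) m = f m \<ominus>\<^bsub>K\<^esub> g m"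
  by (simp add: a_minus_def add_apply uminus_apply)

lemma span_eq: "I = {c \<odot>\<^bsub>A\<^esub> basis_elt K z | c. c \<in> carrier K}"
  by (simp add: basis_span_def basis_elt_def)

text \<open>Turns membership in the ideal into a pointwise condition; the scalar is recovered as the
  coefficient at \<open>z\<close>.\<close>

lemma span_iff: "f \<in> I \<longleftrightarrow> f \<in> carrier A \<and> (\<forall>m. m \<noteq> z \<longrightarrow> f m = \<zero>\<^bsub>K\<^esub>)"
proof
  assume "f \<in> I"
  then obtain c where c: "c \<in> carrier K" "f = c \<odot>\<^bsub>A\<^esub> basis_elt K z"
    by (auto simp: span_eq)
  then show "f \<in> carrier A \<and> (\<forall>m. m \<noteq> z \<longrightarrow> f m = \<zero>\<^bsub>K\<^esub>)"
    by (simp add: smult_apply) (simp add: basis_elt_def)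
next
  assume f: "f \<in> carrier A \<and> (\<forall>m. m \<noteq> z \<longrightarrow> f m = \<zero>\<^bsub>K\<^esub>)"
  then have "f = f z \<odot>\<^bsub>A\<^esub> basis_elt K z"
    by (auto simp: fun_eq_iff smult_apply) (auto simp: basis_elt_def)
  then show "f \<in> I"
    using f coeff_closed by (auto simp: span_eq)
qed

text \<open>Functionals that kill \<open>z\<close> are the ones that factor through the quotient by
  \<open>I\<close>.\<close>

lemma lin_ext_span:
  assumes "f \<in> I" "\<phi> z = \<zero>\<^bsub>K\<^esub>"
  shows "lin_ext K \<phi> f = \<zero>\<^bsub>K\<^esub>"
  unfolding lin_ext_def
proof (rule K.add.finprod_one_eqI)
  fix m assume "m \<in> msupp K f"
  then have "m = z"
    using assms(1) by (auto simp: span_iff msupp_def)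
  then show "f m \<otimes>\<^bsub>K\<^esub> \<phi> m = \<zero>\<^bsub>K\<^esub>"
    using assms by (simp add: span_iff)
qed

lemma ideal_span: "ideal I A"
proof (rule idealI)
  show "subgroup I (add_monoid A)"
  proof (rule A.add.subgroupI)
    show "I \<noteq> {}"
      using span_iff[of "\<zero>\<^bsub>A\<^esub>"] by (auto simp: zero_apply)
    show "\<ominus>\<^bsub>A\<^esub> f \<in> I" if "f \<in> I" for f
      using that by (simp add: span_iff uminus_apply)
    show "f \<oplus>\<^bsub>A\<^esub> g \<in> I" if "f \<in> I" "g \<in> I" for f g
      using that by (simp add: span_iff add_apply)
    show "I \<subseteq> carrier A"
      by (auto simp only: span_iff)
  qed
  fix f g assume f: "f \<in> I" and g: "g \<in> carrier A"
  have fA: "f \<in> carrier A"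
    using f by (simp add: span_iff)
  have *: "(g \<otimes>\<^bsub>A\<^esub> f) m = \<zero>\<^bsub>K\<^esub> \<and> (f \<otimes>\<^bsub>A\<^esub> g) m = \<zero>\<^bsub>K\<^esub>" if m: "m \<noteq> z" for m
  proof (cases "m \<in> carrier M")
    case True
    \<comment> \<open>The coefficient functional at \<open>m\<close> kills \<open>z\<close>. Since
      \<open>z\<close> absorbs products on either side, the functionals obtained from it by
      multiplying with \<open>g\<close> on the left or on the right kill \<open>z\<close> too, hence
      vanish on \<open>f\<close>.\<close>
    let ?d = "basis_elt K m"
    have d: "\<And>x. ?d x \<in> carrier K" "?d z = \<zero>\<^bsub>K\<^esub>"
      using m by (auto simp: basis_elt_def)
    have "(g \<otimes>\<^bsub>A\<^esub> f) m = lin_ext K (\<lambda>a. lin_ext K (\<lambda>b. ?d (a \<otimes>\<^bsub>M\<^esub> b)) f) g"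
      by (subst coeff_eq_lin_ext) (use True fA g d in \<open>simp_all add: lin_ext_mult\<close>)
    also have "\<dots> = lin_ext K (\<lambda>_. \<zero>\<^bsub>K\<^esub>) g"
      using f fA g d by (intro lin_ext_cong lin_ext_span) (auto simp: mem_msupp_carrier)
    also have "\<dots> = \<zero>\<^bsub>K\<^esub>"
      using g by (rule lin_ext_zero_fun)
    finally have gf: "(g \<otimes>\<^bsub>A\<^esub> f) m = \<zero>\<^bsub>K\<^esub>" .
    have "(f \<otimes>\<^bsub>A\<^esub> g) m = lin_ext K (\<lambda>a. lin_ext K (\<lambda>b. ?d (a \<otimes>\<^bsub>M\<^esub> b)) g) f"
      by (subst coeff_eq_lin_ext) (use True fA g d in \<open>simp_all add: lin_ext_mult\<close>)
    also have "\<dots> = \<zero>\<^bsub>K\<^esub>"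
    proof (rule lin_ext_span[OF f])
      have "lin_ext K (\<lambda>b. ?d (z \<otimes>\<^bsub>M\<^esub> b)) g = lin_ext K (\<lambda>_. \<zero>\<^bsub>K\<^esub>) g"
        using g d by (intro lin_ext_cong) (auto simp: mem_msupp_carrier)
      then show "lin_ext K (\<lambda>b. ?d (z \<otimes>\<^bsub>M\<^esub> b)) g = \<zero>\<^bsub>K\<^esub>"
        using g by (simp add: lin_ext_zero_fun)
    qed
    finally show ?thesis
      using gf by simp
  next
    case False
    then show ?thesis
      using fA g by (simp add: coeff_outside)
  qed
  show "g \<otimes>\<^bsub>A\<^esub> f \<in> I" "f \<otimes>\<^bsub>A\<^esub> g \<in> I"
    using * fA g by (simp_all add: span_iff)
qed (rule ring_A)

sublocale I: ideal I A
  by (rule ideal_span)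

text \<open>The working description of the quotient: a coset forgets exactly the coefficient at
  \<open>z\<close>.\<close>

lemma coset_eq_iff:
  assumes "f \<in> carrier A" "g \<in> carrier A"
  shows "I +>\<^bsub>A\<^esub> f = I +>\<^bsub>A\<^esub> g \<longleftrightarrow> (\<forall>m. m \<noteq> z \<longrightarrow> f m = g m)"
proof -
  have "I +>\<^bsub>A\<^esub> f = I +>\<^bsub>A\<^esub> g \<longleftrightarrow> f \<ominus>\<^bsub>A\<^esub> g \<in> I"
    using A.quotient_eq_iff_same_a_r_cos[OF ideal_span] assms by auto
  also have "\<dots> \<longleftrightarrow> (\<forall>m. m \<noteq> z \<longrightarrow> f m = g m)"
    using assms by (simp add: span_iff minus_apply)
  finally show ?thesis .
qed

section \<open>Operations of the contracted algebra on representatives\<close>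

lemma carrier_Q: "carrier Q = (\<lambda>f. I +>\<^bsub>A\<^esub> f) ` carrier A"
  by (auto simp: contracted_algebra_def quot_algebra_def ring.defs FactRing_simps)

lemma zero_Q: "\<zero>\<^bsub>Q\<^esub> = I +>\<^bsub>A\<^esub> \<zero>\<^bsub>A\<^esub>"
proof -
  have "I +>\<^bsub>A\<^esub> \<zero>\<^bsub>A\<^esub> = I"
    by (rule A.a_coset_add_zero[OF I.a_subset])
  then show ?thesis
    by (simp add: contracted_algebra_def quot_algebra_def ring.defs FactRing_def)
qed

lemma one_Q: "\<one>\<^bsub>Q\<^esub> = I +>\<^bsub>A\<^esub> \<one>\<^bsub>A\<^esub>"
  by (simp add: contracted_algebra_def quot_algebra_def ring.defs FactRing_def)

lemma mult_Q:
  "f \<in> carrier A \<Longrightarrow> g \<in> carrier A \<Longrightarrow>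
     (I +>\<^bsub>A\<^esub> f) \<otimes>\<^bsub>Q\<^esub> (I +>\<^bsub>A\<^esub> g) = I +>\<^bsub>A\<^esub> (f \<otimes>\<^bsub>A\<^esub> g)"
  by (simp add: contracted_algebra_def quot_algebra_def ring.defs FactRing_def I.rcoset_mult_add)

lemma add_Q:
  "f \<in> carrier A \<Longrightarrow> g \<in> carrier A \<Longrightarrow>
     (I +>\<^bsub>A\<^esub> f) \<oplus>\<^bsub>Q\<^esub> (I +>\<^bsub>A\<^esub> g) = I +>\<^bsub>A\<^esub> (f \<oplus>\<^bsub>A\<^esub> g)"
  by (simp add: contracted_algebra_def quot_algebra_def ring.defs FactRing_def I.a_rcos_sum)

text \<open>Scalar multiplication of a coset is a union over all its representatives. They agree off
  \<open>z\<close>, so every one yields the same coset and the union collapses to it.\<close>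

lemma smult_Q:
  assumes c: "c \<in> carrier K" and f: "f \<in> carrier A"
  shows "c \<odot>\<^bsub>Q\<^esub> (I +>\<^bsub>A\<^esub> f) = I +>\<^bsub>A\<^esub> (c \<odot>\<^bsub>A\<^esub> f)"
proof -
  have "I +>\<^bsub>A\<^esub> (c \<odot>\<^bsub>A\<^esub> g) = I +>\<^bsub>A\<^esub> (c \<odot>\<^bsub>A\<^esub> f)" if g: "g \<in> I +>\<^bsub>A\<^esub> f" for g
  proof -
    have gA: "g \<in> carrier A"
      using g f I.a_elemrcos_carrier by blast
    have "I +>\<^bsub>A\<^esub> g = I +>\<^bsub>A\<^esub> f"
      using A.a_repr_independence[OF g f I.a_subgroup] by simp
    then have "\<forall>m. m \<noteq> z \<longrightarrow> g m = f m"
      using gA f by (simp add: coset_eq_iff)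
    then show ?thesis
      using c gA f by (simp add: coset_eq_iff smult_apply)
  qed
  moreover have "f \<in> I +>\<^bsub>A\<^esub> f"
    using f by (rule I.a_rcos_self)
  ultimately have "(\<Union>g\<in>I +>\<^bsub>A\<^esub> f. I +>\<^bsub>A\<^esub> (c \<odot>\<^bsub>A\<^esub> g)) = I +>\<^bsub>A\<^esub> (c \<odot>\<^bsub>A\<^esub> f)"
    by blast
  then show ?thesis
    by (simp add: contracted_algebra_def quot_algebra_def ring.defs module.defs)
qed

section \<open>Splitting off the field by the augmentation\<close>

lemma augmentation_alg_iso:
  "(\<lambda>f. (lin_ext K (\<lambda>_. \<one>\<^bsub>K\<^esub>) f, I +>\<^bsub>A\<^esub> f)) \<in> alg_iso K A (prod_algebra (base_algebra K) Q)"
proof -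
  \<comment> \<open>The augmentation adds up all coefficients. It maps the multiple of
    \<open>z\<close> by \<open>c\<close> to \<open>c\<close>, hence is bijective from
    \<open>I\<close> to \<open>K\<close>, which makes it complementary to the quotient map.\<close>
  let ?e = "lin_ext K (\<lambda>_. \<one>\<^bsub>K\<^esub>)"
  let ?h = "\<lambda>f. (?e f, I +>\<^bsub>A\<^esub> f)"
  let ?P = "prod_algebra (base_algebra K) Q"
  note P_simps = prod_algebra_def base_algebra_def RDirProd_def DirProd_def ring.defs monoid.defs module.defs
  have carrier_P: "carrier ?P = carrier K \<times> carrier Q"
    by (simp add: P_simps)
  have e_mult: "?e (f \<otimes>\<^bsub>A\<^esub> g) = ?e f \<otimes>\<^bsub>K\<^esub> ?e g" if "f \<in> carrier A" "g \<in> carrier A" for f g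
  proof -
    have "?e (f \<otimes>\<^bsub>A\<^esub> g) = lin_ext K (\<lambda>_. ?e g) f"
      using that by (simp add: lin_ext_mult)
    also have "\<dots> = ?e f \<otimes>\<^bsub>K\<^esub> ?e g"
    proof -
      have "lin_ext K (\<lambda>_. ?e g) f = (\<Oplus>\<^bsub>K\<^esub>m\<in>msupp K f. f m \<otimes>\<^bsub>K\<^esub> \<one>\<^bsub>K\<^esub> \<otimes>\<^bsub>K\<^esub> ?e g)"
        unfolding lin_ext_def[of _ _ f] by (rule K.finsum_cong') (use that in auto)
      also have "\<dots> = ?e f \<otimes>\<^bsub>K\<^esub> ?e g"
        unfolding lin_ext_def[of _ _ f]
        by (rule K.finsum_ldistr[symmetric]) (use that in \<open>auto simp: finite_msupp\<close>)
      finally show ?thesis .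
    qed
    finally show ?thesis .
  qed
  have "?h \<in> ring_hom A ?P"
  proof (rule ring_hom_memI)
    show "?h f \<in> carrier ?P" if "f \<in> carrier A" for f
      using that by (simp add: carrier_P carrier_Q)
    show "?h (f \<otimes>\<^bsub>A\<^esub> g) = ?h f \<otimes>\<^bsub>?P\<^esub> ?h g" if "f \<in> carrier A" "g \<in> carrier A" for f g
      using that by (simp add: e_mult flip: mult_Q) (simp add: P_simps)
    show "?h (f \<oplus>\<^bsub>A\<^esub> g) = ?h f \<oplus>\<^bsub>?P\<^esub> ?h g" if "f \<in> carrier A" "g \<in> carrier A" for f g
      using that by (simp add: lin_ext_add flip: add_Q) (simp add: P_simps)
    show "?h \<one>\<^bsub>A\<^esub> = \<one>\<^bsub>?P\<^esub>"
      by (simp add: lin_ext_basis one_eq flip: one_Q) (simp add: P_simps one_Q one_eq)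
  qed
  moreover have "bij_betw ?h (carrier A) (carrier ?P)"
    unfolding bij_betw_def
  proof
    show "inj_on ?h (carrier A)"
    proof (rule inj_onI)
      fix f g assume fg: "f \<in> carrier A" "g \<in> carrier A" "?h f = ?h g"
      then have "f \<ominus>\<^bsub>A\<^esub> g \<in> I"
        by (simp add: coset_eq_iff span_iff minus_apply)
      then obtain c where c: "c \<in> carrier K" "f \<ominus>\<^bsub>A\<^esub> g = c \<odot>\<^bsub>A\<^esub> basis_elt K z"
        by (auto simp: span_eq)
      have f_eq: "f = c \<odot>\<^bsub>A\<^esub> basis_elt K z \<oplus>\<^bsub>A\<^esub> g"
        using fg(1,2) unfolding c(2)[symmetric]
        by (simp add: a_minus_def A.a_assoc A.l_neg)
      \<comment> \<open>The difference of \<open>f\<close> and \<open>g\<close> is \<open>c\<close>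
        times \<open>z\<close>, which has augmentation \<open>c\<close>; equal augmentations
        therefore force \<open>c\<close> to be zero.\<close>
      have "?e f = c \<oplus>\<^bsub>K\<^esub> ?e g"
        using fg(2) c(1) by (subst f_eq) (simp add: lin_ext_add lin_ext_smult lin_ext_basis)
      moreover have "?e f = ?e g" "?e g \<in> carrier K"
        using fg by auto
      ultimately have "c = \<zero>\<^bsub>K\<^esub>"
        using c(1) K.add.r_cancel_one by metis
      then show "f = g"
        using fg(2) by (subst f_eq) (auto simp: fun_eq_iff add_apply smult_apply)
    qed
    have "\<exists>g\<in>carrier A. ?h g = (c, I +>\<^bsub>A\<^esub> f)" if "c \<in> carrier K" "f \<in> carrier A" for c f
    proof -
      \<comment> \<open>Adding a multiple of \<open>z\<close> corrects the augmentation to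
        \<open>c\<close> and leaves the coset unchanged.\<close>
      let ?g = "(c \<ominus>\<^bsub>K\<^esub> ?e f) \<odot>\<^bsub>A\<^esub> basis_elt K z \<oplus>\<^bsub>A\<^esub> f"
      have e: "?e f \<in> carrier K"
        using that by simp
      have g: "?g \<in> carrier A"
        using that e by simp
      have "?e ?g = (c \<ominus>\<^bsub>K\<^esub> ?e f) \<oplus>\<^bsub>K\<^esub> ?e f"
        using that e by (simp add: lin_ext_add lin_ext_smult lin_ext_basis)
      also have "\<dots> = c"
        using that e by (simp add: a_minus_def K.a_assoc K.l_neg)
      finally have "?e ?g = c" .
      moreover have "I +>\<^bsub>A\<^esub> ?g = I +>\<^bsub>A\<^esub> f"
        using that e g by (auto simp: coset_eq_iff add_apply smult_apply) (simp add: basis_elt_def)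
      ultimately show ?thesis
        using g by blast
    qed
    then show "?h ` carrier A = carrier ?P"
      using carrier_Q carrier_P by (auto simp: image_iff) metis
  qed
  moreover have "?h (c \<odot>\<^bsub>A\<^esub> f) = c \<odot>\<^bsub>?P\<^esub> ?h f" if "c \<in> carrier K" "f \<in> carrier A" for c f
    using that by (simp add: lin_ext_smult flip: smult_Q) (simp add: P_simps)
  ultimately show ?thesis
    by (simp add: alg_iso_def ring_iso_def)
qed

section \<open>Central elements and connectedness of the contracted algebra\<close>

lemma central_lin_ext:
  assumes f: "f \<in> carrier A"
    and central: "\<And>S. S \<in> carrier Q \<Longrightarrow> (I +>\<^bsub>A\<^esub> f) \<otimes>\<^bsub>Q\<^esub> S = S \<otimes>\<^bsub>Q\<^esub> (I +>\<^bsub>A\<^esub> f)"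
    and x: "x \<in> carrier M"
    and \<phi>: "\<And>m. \<phi> m \<in> carrier K" "\<phi> z = \<zero>\<^bsub>K\<^esub>"
  shows "lin_ext K (\<lambda>p. \<phi> (p \<otimes>\<^bsub>M\<^esub> x)) f = lin_ext K (\<lambda>p. \<phi> (x \<otimes>\<^bsub>M\<^esub> p)) f"
proof -
  let ?x = "basis_elt K x"
  \<comment> \<open>Centrality in the quotient makes \<open>f\<close> and \<open>?x\<close> commute
    only modulo \<open>I\<close>. The commutator \<open>?d\<close> is invisible to
    \<open>\<phi>\<close> because \<open>\<phi>\<close> kills \<open>z\<close>.\<close>
  let ?d = "f \<otimes>\<^bsub>A\<^esub> ?x \<ominus>\<^bsub>A\<^esub> ?x \<otimes>\<^bsub>A\<^esub> f"
  have "(I +>\<^bsub>A\<^esub> f) \<otimes>\<^bsub>Q\<^esub> (I +>\<^bsub>A\<^esub> ?x) = (I +>\<^bsub>A\<^esub> ?x) \<otimes>\<^bsub>Q\<^esub> (I +>\<^bsub>A\<^esub> f)"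
    using x by (intro central) (simp add: carrier_Q)
  then have "I +>\<^bsub>A\<^esub> (f \<otimes>\<^bsub>A\<^esub> ?x) = I +>\<^bsub>A\<^esub> (?x \<otimes>\<^bsub>A\<^esub> f)"
    using f x by (simp add: mult_Q)
  then have "?d \<in> I"
    using f x A.quotient_eq_iff_same_a_r_cos[OF ideal_span] by simp
  then have "lin_ext K \<phi> ?d = \<zero>\<^bsub>K\<^esub>"
    using \<phi>(2) by (rule lin_ext_span)
  moreover have "lin_ext K \<phi> (?d \<oplus>\<^bsub>A\<^esub> ?x \<otimes>\<^bsub>A\<^esub> f) =
      lin_ext K \<phi> ?d \<oplus>\<^bsub>K\<^esub> lin_ext K \<phi> (?x \<otimes>\<^bsub>A\<^esub> f)"
    using f x \<phi> by (intro lin_ext_add) simp_all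
  moreover have "?d \<oplus>\<^bsub>A\<^esub> ?x \<otimes>\<^bsub>A\<^esub> f = f \<otimes>\<^bsub>A\<^esub> ?x"
    using f x by (simp add: a_minus_def A.a_assoc A.l_neg)
  ultimately have "lin_ext K \<phi> (f \<otimes>\<^bsub>A\<^esub> ?x) = lin_ext K \<phi> (?x \<otimes>\<^bsub>A\<^esub> f)"
    using f x \<phi> by simp
  then show ?thesis
    using f x \<phi> by (simp add: lin_ext_mult lin_ext_basis)
qed

text \<open>A central idempotent is the class of \<open>a\<close> times the identity, and then
  \<open>a\<close> is idempotent in \<open>K\<close>. A domain has no idempotents besides zero and
  one.\<close>

lemma connected_contracted_if_center_scalar:
  assumes K: "domain K" and nontrivial: "\<one>\<^bsub>M\<^esub> \<noteq> z"
    and scalar: "\<And>f. f \<in> carrier A \<Longrightarrow>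
      (\<And>S. S \<in> carrier Q \<Longrightarrow> (I +>\<^bsub>A\<^esub> f) \<otimes>\<^bsub>Q\<^esub> S = S \<otimes>\<^bsub>Q\<^esub> (I +>\<^bsub>A\<^esub> f)) \<Longrightarrow>
      \<exists>a\<in>carrier K. I +>\<^bsub>A\<^esub> f = I +>\<^bsub>A\<^esub> (a \<odot>\<^bsub>A\<^esub> \<one>\<^bsub>A\<^esub>)"
  shows "connected_algebra Q"
proof -
  have one_at: "\<one>\<^bsub>A\<^esub> \<one>\<^bsub>M\<^esub> = \<one>\<^bsub>K\<^esub>"
    by (simp add: one_eq basis_elt_def)
  have K01: "\<one>\<^bsub>K\<^esub> \<noteq> \<zero>\<^bsub>K\<^esub>"
    using K by (rule domain.one_not_zero)
  have "\<zero>\<^bsub>Q\<^esub> \<noteq> \<one>\<^bsub>Q\<^esub>"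
    using K01 nontrivial one_at by (auto simp: zero_Q one_Q coset_eq_iff zero_apply)
  moreover have "S = \<zero>\<^bsub>Q\<^esub> \<or> S = \<one>\<^bsub>Q\<^esub>" if S: "S \<in> central_idempotents Q" for S
  proof -
    obtain f where f: "f \<in> carrier A" "S = I +>\<^bsub>A\<^esub> f"
      using S by (auto simp: central_idempotents_def carrier_Q)
    obtain a where a: "a \<in> carrier K" "S = I +>\<^bsub>A\<^esub> (a \<odot>\<^bsub>A\<^esub> \<one>\<^bsub>A\<^esub>)"
      using scalar[OF f(1)] S f(2) by (auto simp: central_idempotents_def)
    let ?a = "a \<odot>\<^bsub>A\<^esub> \<one>\<^bsub>A\<^esub>"
    have aA: "?a \<in> carrier A"
      using a by simp
    have "I +>\<^bsub>A\<^esub> (?a \<otimes>\<^bsub>A\<^esub> ?a) = I +>\<^bsub>A\<^esub> ?a"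
      using S aA unfolding a(2) by (simp add: central_idempotents_def mult_Q)
    \<comment> \<open>The coefficient at the identity survives in the quotient because the identity
      of \<open>M\<close> is not \<open>z\<close>.\<close>
    then have "(?a \<otimes>\<^bsub>A\<^esub> ?a) \<one>\<^bsub>M\<^esub> = a"
      using aA a(1) nontrivial by (simp add: coset_eq_iff smult_apply one_at)
    moreover have "?a \<otimes>\<^bsub>A\<^esub> ?a = (a \<otimes>\<^bsub>K\<^esub> a) \<odot>\<^bsub>A\<^esub> \<one>\<^bsub>A\<^esub>"
      by (rule alg_eqI)
        (use a in \<open>auto simp: lin_ext_mult lin_ext_smult lin_ext_basis one_eq K.m_assoc\<close>)
    ultimately have "a \<otimes>\<^bsub>K\<^esub> a = a"
      using a(1) by (simp add: smult_apply one_at)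
    then have "a \<otimes>\<^bsub>K\<^esub> (a \<ominus>\<^bsub>K\<^esub> \<one>\<^bsub>K\<^esub>) = \<zero>\<^bsub>K\<^esub>"
      using a(1) by (simp add: K.r_minus K.r_distr a_minus_def K.r_neg)
    then have "a = \<zero>\<^bsub>K\<^esub> \<or> a = \<one>\<^bsub>K\<^esub>"
      using a(1) domain.integral[OF K, of a "a \<ominus>\<^bsub>K\<^esub> \<one>\<^bsub>K\<^esub>"] by auto
    then show ?thesis
      using a aA by (auto simp: zero_Q one_Q coset_eq_iff smult_apply zero_apply)
  qed
  moreover have "{\<zero>\<^bsub>Q\<^esub>, \<one>\<^bsub>Q\<^esub>} \<subseteq> central_idempotents Q"
    by (auto simp: central_idempotents_def carrier_Q zero_Q one_Q mult_Q)
  ultimately show ?thesis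
    unfolding connected_algebra_def by blast
qed

end

lemma connected_base_algebra:
  assumes "domain K"
  shows "connected_algebra (base_algebra K)"
proof -
  interpret domain K by fact
  \<comment> \<open>A nonzero idempotent \<open>a\<close> can be cancelled from
    \<open>a a = a 1\<close>.\<close>
  have "a = \<zero>\<^bsub>K\<^esub> \<or> a = \<one>\<^bsub>K\<^esub>" if "a \<in> carrier K" "a \<otimes>\<^bsub>K\<^esub> a = a" for a
    using that m_lcancel[of a a "\<one>\<^bsub>K\<^esub>"] by auto
  then show ?thesis
    by (auto simp: connected_algebra_def central_idempotents_def base_algebra_def m_comm)
qed

section \<open>The center of the contracted algebra of the partial Catalan monoid\<close>

text \<open>The single chain of inequalities covers the domain, the range and the order-decreasing
  condition at once.\<close>

lemma PC_iff:
  "f \<in> carrier (PC n) \<longleftrightarrow>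
     (\<forall>x a. f x = Some a \<longrightarrow> 1 \<le> a \<and> a \<le> x \<and> x \<le> n) \<and>
     (\<forall>x y a b. f x = Some a \<longrightarrow> f y = Some b \<longrightarrow> x \<le> y \<longrightarrow> a \<le> b)"
  by (simp add: PC_def dom_def ran_def subset_eq) (fastforce dest: spec)

lemma mult_PC [simp]: "f \<otimes>\<^bsub>PC n\<^esub> g = f \<circ>\<^sub>m g"
  and one_PC: "\<one>\<^bsub>PC n\<^esub> = Some |` {1..n}"
  by (simp_all add: PC_def)

lemma partial_id_PC: "B \<subseteq> {1..n} \<Longrightarrow> Some |` B \<in> carrier (PC n)"
  by (auto simp: PC_iff restrict_map_def split: if_splits)

lemma const_PC: "B \<subseteq> {1..n} \<Longrightarrow> (\<lambda>_. Some 1) |` B \<in> carrier (PC n)"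
  by (auto simp: PC_iff restrict_map_def split: if_splits)

text \<open>Let \<open>d\<close> be the largest point of the domain that is not fixed. It is the
  image of some \<open>e\<close>, and \<open>e > d\<close> since \<open>m\<close> is decreasing and
  moves \<open>d\<close>. By maximality \<open>e\<close> is fixed, so its image is not
  \<open>d\<close>. The contrapositive supplies a domain point outside the image for each map that
  is not a partial identity.\<close>

lemma PC_partial_id_if_dom_subset_ran:
  assumes m: "m \<in> carrier (PC n)" and sub: "dom m \<subseteq> ran m"
  shows "m \<subseteq>\<^sub>m Some"
proof (rule ccontr)
  let ?D = "{d \<in> dom m. m d \<noteq> Some d}"
  assume "\<not> m \<subseteq>\<^sub>m Some"
  then have "?D \<noteq> {}"
    by (auto simp: map_le_def)
  moreover have "?D \<subseteq> {..n}"
    using m by (auto simp: PC_iff)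
  then have fin: "finite ?D"
    by (rule finite_subset) simp
  ultimately have d: "Max ?D \<in> ?D"
    by (intro Max_in)
  then obtain e where e: "m e = Some (Max ?D)"
    using sub by (auto simp: ran_def)
  then have "Max ?D \<le> e"
    using m by (auto simp: PC_iff)
  moreover have "e \<noteq> Max ?D"
    using d e by auto
  ultimately have "e \<notin> ?D"
    using Max_ge[OF fin, of e] by auto
  then show False
    using e \<open>e \<noteq> Max ?D\<close> by auto
qed

text \<open>The indicator of the up-set generated by \<open>R\<close> in the extension order. For
  \<open>R = {m}\<close> its linear extension at \<open>f\<close> is the sum \<open>F f m\<close>;
  larger \<open>R\<close> are needed for the self-maps of a set.\<close>

definition up_ind :: "('k, 'x) ring_scheme \<Rightarrow> ('a \<rightharpoonup> 'b) set \<Rightarrow> ('a \<rightharpoonup> 'b) \<Rightarrow> 'k"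
  where "up_ind K R p = (if \<exists>r\<in>R. r \<subseteq>\<^sub>m p then \<one>\<^bsub>K\<^esub> else \<zero>\<^bsub>K\<^esub>)"

section \<open>Sums over up-sets in the extension order\<close>

locale partial_catalan_algebra = cring K for K :: "('k, 'x) ring_scheme" +
  fixes n :: nat
begin

sublocale monoid_zero_ring K "PC n" Map.empty
  by (intro monoid_zero_ring.intro monoid_ring.intro monoid_zero_ring_axioms.intro
      PC_monoid PC_zero cring_axioms)

lemma up_ind_closed [simp]: "up_ind K R p \<in> carrier K"
  by (simp add: up_ind_def)

text \<open>Makes these functionals admissible in \<open>central_lin_ext\<close>.\<close>

lemma up_ind_empty: "m \<noteq> Map.empty \<Longrightarrow> up_ind K {m} Map.empty = \<zero>\<^bsub>K\<^esub>"
  by (auto simp: up_ind_def map_le_def)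

text \<open>At a support element with maximal domain, the sum over the up-set is a single coefficient.\<close>

lemma coeff_eq_zero_if_up_ind_eq_zero:
  assumes f: "f \<in> carrier A"
    and up: "\<And>m. m \<in> carrier (PC n) \<Longrightarrow> m \<noteq> Map.empty \<Longrightarrow> lin_ext K (up_ind K {m}) f = \<zero>\<^bsub>K\<^esub>"
    and m: "m \<noteq> Map.empty"
  shows "f m = \<zero>\<^bsub>K\<^esub>"
proof (rule ccontr)
  let ?S = "msupp K f - {Map.empty}"
  let ?c = "\<lambda>p. card (dom p)"
  assume "f m \<noteq> \<zero>\<^bsub>K\<^esub>"
  then have "m \<in> ?S"
    using m by (simp add: msupp_def)
  moreover have fin: "finite ?S"
    using f by (simp add: finite_msupp)
  ultimately have "Max (?c ` ?S) \<in> ?c ` ?S"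
    by (intro Max_in) auto
  then obtain q where q: "q \<in> ?S" "?c q = Max (?c ` ?S)"
    by (metis (no_types, lifting) imageE)
  have qM: "q \<in> carrier (PC n)"
    using q f mem_msupp_carrier by blast
  have "lin_ext K (up_ind K {q}) f = lin_ext K (basis_elt K q) f"
  proof (rule lin_ext_cong[OF f])
    fix p assume p: "p \<in> msupp K f"
    show "up_ind K {q} p = basis_elt K q p"
    proof (cases "q \<subseteq>\<^sub>m p")
      case True
      \<comment> \<open>An extension of the nonempty map \<open>q\<close> is nonempty, so it
        competes in the maximum. Its domain cannot be larger than that of \<open>q\<close>, which
        forces \<open>p = q\<close>.\<close>
      then have "p \<in> ?S"
        using p q(1) map_le_implies_dom_le[OF True] by auto
      then have "?c p \<le> ?c q"
        using q(2) fin by simp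
      moreover have "p \<in> carrier (PC n)"
        using p f mem_msupp_carrier by blast
      then have "dom p \<subseteq> {..n}"
        by (auto simp: PC_iff)
      then have "finite (dom p)"
        by (rule finite_subset) simp
      ultimately have "dom q = dom p"
        using map_le_implies_dom_le[OF True] by (meson card_seteq)
      then have "p = q"
        using True by (metis map_le_antisym map_le_def)
      then show ?thesis
        by (simp add: up_ind_def basis_elt_def)
    next
      case False
      then show ?thesis
        by (auto simp: up_ind_def basis_elt_def)
    qed
  qed (simp add: basis_elt_def)
  also have "\<dots> = f q"
    using f qM by (simp only: coeff_eq_lin_ext[symmetric])
  finally have "f q = \<zero>\<^bsub>K\<^esub>"
    using up[OF qM] q(1) by simp
  then show False
    using q(1) by (simp add: msupp_def)
qed

text \<open>Distinct maps with the same domain have no common extension. Their up-sets are therefore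
  disjoint, and the indicators add up.\<close>

lemma lin_ext_up_ind_insert:
  assumes f: "f \<in> carrier A" and dom: "\<And>r. r \<in> insert s R \<Longrightarrow> dom r = B" and s: "s \<notin> R"
  shows "lin_ext K (up_ind K (insert s R)) f =
    lin_ext K (up_ind K {s}) f \<oplus>\<^bsub>K\<^esub> lin_ext K (up_ind K R) f"
proof -
  have "\<not> (\<exists>r\<in>R. r \<subseteq>\<^sub>m p)" if "s \<subseteq>\<^sub>m p" for p
  proof
    assume "\<exists>r\<in>R. r \<subseteq>\<^sub>m p"
    then obtain r where r: "r \<in> R" "r \<subseteq>\<^sub>m p"
      by blast
    then have "dom r = dom s"
      using dom by auto
    then have "r = s"
      using r(2) that by (metis map_le_antisym map_le_def)
    then show False
      using r(1) s by simp
  qed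
  then have "up_ind K (insert s R) = (\<lambda>p. up_ind K {s} p \<oplus>\<^bsub>K\<^esub> up_ind K R p)"
    by (auto simp: up_ind_def fun_eq_iff)
  then show ?thesis
    using f by (simp add: lin_ext_add_fun)
qed

lemma lin_ext_up_ind_eq_zero:
  assumes f: "f \<in> carrier A" and R: "finite R"
    and dom: "\<And>r. r \<in> R \<Longrightarrow> dom r = B"
    and zero: "\<And>r. r \<in> R \<Longrightarrow> lin_ext K (up_ind K {r}) f = \<zero>\<^bsub>K\<^esub>"
  shows "lin_ext K (up_ind K R) f = \<zero>\<^bsub>K\<^esub>"
  using R dom zero
proof (induction R rule: finite_induct)
  case empty
  have "up_ind K {} = (\<lambda>_ :: nat \<rightharpoonup> nat. \<zero>\<^bsub>K\<^esub>)"
    by (simp add: up_ind_def fun_eq_iff)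
  then show ?case
    using lin_ext_zero_fun[OF f] by simp
next
  case (insert s R)
  then have "lin_ext K (up_ind K (insert s R)) f =
      lin_ext K (up_ind K {s}) f \<oplus>\<^bsub>K\<^esub> lin_ext K (up_ind K R) f"
    by (intro lin_ext_up_ind_insert[OF f, where B = B]) auto
  then show ?case
    using insert by simp
qed

section \<open>Central elements are scalars\<close>

context
  fixes f
  assumes f: "f \<in> carrier A"
    and central: "\<And>S. S \<in> carrier Q \<Longrightarrow> (I +>\<^bsub>A\<^esub> f) \<otimes>\<^bsub>Q\<^esub> S = S \<otimes>\<^bsub>Q\<^esub> (I +>\<^bsub>A\<^esub> f)"
begin

lemma central_up_ind:
  assumes "x \<in> carrier (PC n)" "m \<noteq> Map.empty"
  shows "lin_ext K (\<lambda>p. up_ind K {m} (p \<circ>\<^sub>m x)) f = lin_ext K (\<lambda>p. up_ind K {m} (x \<circ>\<^sub>m p)) f"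
  using central_lin_ext[OF f central assms(1), of "up_ind K {m}"] up_ind_empty[OF assms(2)] by simp

text \<open>Some \<open>d\<close> in the domain of \<open>m\<close> lies outside its image.
  Commuting \<open>f\<close> with the identity \<open>?x\<close> on the image gives zero on the side
  where \<open>?x\<close> acts first, and \<open>F f m\<close> on the other.\<close>

lemma central_up_ind_nonid:
  assumes m: "m \<in> carrier (PC n)" and nonid: "\<not> m \<subseteq>\<^sub>m Some"
  shows "lin_ext K (up_ind K {m}) f = \<zero>\<^bsub>K\<^esub>"
proof -
  let ?x = "Some |` ran m"
  obtain d where d: "d \<in> dom m" "d \<notin> ran m"
    using PC_partial_id_if_dom_subset_ran[OF m] nonid by blast
  have "ran m \<subseteq> {1..n}"
    using m by (fastforce simp: PC_iff ran_def)
  then have x: "?x \<in> carrier (PC n)"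
    by (rule partial_id_PC)
  \<comment> \<open>Composition runs from right to left, so \<open>?x\<close> acts first and leaves
    the composite undefined at \<open>d\<close>.\<close>
  have "\<not> m \<subseteq>\<^sub>m p \<circ>\<^sub>m ?x" for p
    using d by (force simp: map_le_def map_comp_def restrict_map_def)
  then have left: "(\<lambda>p. up_ind K {m} (p \<circ>\<^sub>m ?x)) = (\<lambda>_. \<zero>\<^bsub>K\<^esub>)"
    by (simp add: up_ind_def fun_eq_iff)
  have "m \<subseteq>\<^sub>m ?x \<circ>\<^sub>m p \<longleftrightarrow> m \<subseteq>\<^sub>m p" for p
  proof -
    have "m a = (?x \<circ>\<^sub>m p) a \<longleftrightarrow> m a = p a" if "a \<in> dom m" for a
      using that by (auto simp: map_comp_def restrict_map_def ran_def split: option.splits)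
    then show ?thesis
      by (simp add: map_le_def)
  qed
  then have "(\<lambda>p. up_ind K {m} (?x \<circ>\<^sub>m p)) = up_ind K {m}"
    by (simp add: up_ind_def fun_eq_iff)
  then have "lin_ext K (up_ind K {m}) f = lin_ext K (\<lambda>p. up_ind K {m} (?x \<circ>\<^sub>m p)) f"
    by simp
  also have "\<dots> = lin_ext K (\<lambda>p. up_ind K {m} (p \<circ>\<^sub>m ?x)) f"
    using d by (intro central_up_ind[OF x, symmetric]) auto
  also have "\<dots> = \<zero>\<^bsub>K\<^esub>"
    unfolding left using f by (rule lin_ext_zero_fun)
  finally show ?thesis .
qed

text \<open>Multiplying by the constant map \<open>1\<close> on \<open>B\<close> gives, on one side, the sum over all self-maps of
  \<open>B\<close>, of which only the identity contributes.\<close>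

lemma central_up_ind_id:
  assumes B: "B \<subseteq> {1..n}" "B \<noteq> {}"
  shows "lin_ext K (up_ind K {Some |` B}) f = lin_ext K (up_ind K {[1 \<mapsto> 1]}) f"
proof -
  let ?x = "(\<lambda>_. Some (1 :: nat)) |` B"
  let ?R = "{r \<in> carrier (PC n). dom r = B \<and> ran r \<subseteq> B}"
  let ?e = "Some |` B"
  have dom_x: "dom ?x = B" and dom_e: "dom ?e = B"
    by (auto simp: restrict_map_def split: if_splits)
  have x_nonempty: "?x \<noteq> Map.empty"
    using dom_x B(2) by (metis dom_empty)
  have e: "?e \<in> ?R"
    using partial_id_PC[OF B(1)] dom_e by (auto simp: ran_def restrict_map_def split: if_splits)
  have finB: "finite B"
    using B(1) finite_subset by blast
  have finR: "finite ?R"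
    by (rule finite_subset[OF _ finite_set_of_finite_maps[OF finB finB]]) auto
  \<comment> \<open>The composite sends every point of the nonempty set \<open>B\<close> to
    \<open>p 1\<close>, so the condition is that \<open>p\<close> fixes 1.\<close>
  have "?x \<subseteq>\<^sub>m p \<circ>\<^sub>m ?x \<longleftrightarrow> [1 \<mapsto> 1] \<subseteq>\<^sub>m p" for p :: "nat \<rightharpoonup> nat"
    using B(2) by (auto simp: map_le_def dom_x map_comp_def restrict_map_def)
  then have left: "(\<lambda>p. up_ind K {?x} (p \<circ>\<^sub>m ?x)) = up_ind K {[1 \<mapsto> 1]}"
    by (simp add: up_ind_def fun_eq_iff)
  have right: "up_ind K {?x} (?x \<circ>\<^sub>m p) = up_ind K ?R p" if p: "p \<in> carrier (PC n)" for p
  proof -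
    \<comment> \<open>On the other side \<open>p\<close> must map all of \<open>B\<close> into
      \<open>B\<close>, that is, extend one of the self-maps in \<open>?R\<close>, namely its own
      restriction to \<open>B\<close>.\<close>
    have "?x \<subseteq>\<^sub>m ?x \<circ>\<^sub>m p \<longleftrightarrow> (\<forall>d\<in>B. \<exists>c\<in>B. p d = Some c)"
      unfolding map_le_def dom_x
      by (intro ball_cong refl)
        (auto simp: map_comp_def restrict_map_def split: option.splits if_splits)
    also have "\<dots> \<longleftrightarrow> (\<exists>r\<in>?R. r \<subseteq>\<^sub>m p)"
    proof
      assume *: "\<forall>d\<in>B. \<exists>c\<in>B. p d = Some c"
      have "p |` B \<in> carrier (PC n)"
        using p unfolding PC_iff by (auto simp: restrict_map_def split: if_splits)
      moreover have "dom (p |` B) = B"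
        using * by auto
      moreover have "ran (p |` B) \<subseteq> B"
        using * by (fastforce simp: ran_def restrict_map_def split: if_splits)
      moreover have "p |` B \<subseteq>\<^sub>m p"
        by (auto simp: map_le_def)
      ultimately show "\<exists>r\<in>?R. r \<subseteq>\<^sub>m p"
        by blast
    next
      assume "\<exists>r\<in>?R. r \<subseteq>\<^sub>m p"
      then obtain r where r: "dom r = B" "ran r \<subseteq> B" "r \<subseteq>\<^sub>m p"
        by auto
      show "\<forall>d\<in>B. \<exists>c\<in>B. p d = Some c"
      proof
        fix d assume d: "d \<in> B"
        then obtain c where c: "r d = Some c"
          using r(1) by auto
        then have "c \<in> B"
          using r(2) ranI by fast
        moreover have "p d = Some c"
          using r(1,3) c d unfolding map_le_def by simp
        ultimately show "\<exists>c\<in>B. p d = Some c"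
          by blast
      qed
    qed
    finally show ?thesis
      by (simp add: up_ind_def)
  qed
  have nonid: "\<not> r \<subseteq>\<^sub>m Some" if r: "r \<in> ?R - {?e}" for r
  proof
    assume "r \<subseteq>\<^sub>m Some"
    then have "r = ?e"
      using r by (auto simp: map_le_def fun_eq_iff restrict_map_def domIff)
    then show False
      using r by simp
  qed
  have "lin_ext K (up_ind K {[1 \<mapsto> 1]}) f = lin_ext K (\<lambda>p. up_ind K {?x} (?x \<circ>\<^sub>m p)) f"
    unfolding left[symmetric]
    using x_nonempty by (intro central_up_ind const_PC[OF B(1)])
  also have "\<dots> = lin_ext K (up_ind K ?R) f"
    using f by (intro lin_ext_cong right) (auto simp: mem_msupp_carrier)
  \<comment> \<open>The identity of \<open>B\<close> is split off; the remaining members of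
    \<open>?R\<close> are not partial identities, so \<open>central_up_ind_nonid\<close> removes
    them.\<close>
  also have "\<dots> = lin_ext K (up_ind K (insert ?e (?R - {?e}))) f"
    using e by (simp add: insert_absorb)
  also have "\<dots> = lin_ext K (up_ind K {?e}) f \<oplus>\<^bsub>K\<^esub> lin_ext K (up_ind K (?R - {?e})) f"
  proof (rule lin_ext_up_ind_insert[OF f])
    fix r assume "r \<in> insert ?e (?R - {?e})"
    then show "dom r = B"
      using dom_e by (elim insertE) simp_all
  qed simp
  also have "lin_ext K (up_ind K (?R - {?e})) f = \<zero>\<^bsub>K\<^esub>"
  proof (rule lin_ext_up_ind_eq_zero[OF f])
    show "lin_ext K (up_ind K {r}) f = \<zero>\<^bsub>K\<^esub>" if "r \<in> ?R - {?e}" for r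
      using that nonid[OF that] by (intro central_up_ind_nonid) simp_all
  qed (use finR in simp_all)
  also have "lin_ext K (up_ind K {?e}) f \<oplus>\<^bsub>K\<^esub> \<zero>\<^bsub>K\<^esub> = lin_ext K (up_ind K {?e}) f"
    using f by simp
  finally show ?thesis
    by (rule sym)
qed

text \<open>The scalar is the value of \<open>F f\<close> at the identity of \<open>{1}\<close>. The
  sums \<open>F\<close> of the algebra's identity are one at nonempty partial identities and zero at
  all other nonempty maps, so \<open>f\<close> and the scalar multiple have the same sums and agree
  off the empty map.\<close>

lemma central_scalar: "\<exists>a\<in>carrier K. I +>\<^bsub>A\<^esub> f = I +>\<^bsub>A\<^esub> (a \<odot>\<^bsub>A\<^esub> \<one>\<^bsub>A\<^esub>)"
proof
  let ?a = "lin_ext K (up_ind K {[1 \<mapsto> 1]}) f"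
  let ?s = "?a \<odot>\<^bsub>A\<^esub> \<one>\<^bsub>A\<^esub>"
  show a: "?a \<in> carrier K"
    using f by simp
  then have s: "?s \<in> carrier A"
    by simp
  have "(f \<ominus>\<^bsub>A\<^esub> ?s) m = \<zero>\<^bsub>K\<^esub>" if "m \<noteq> Map.empty" for m
  proof (rule coeff_eq_zero_if_up_ind_eq_zero[OF _ _ that])
    fix m assume m: "m \<in> carrier (PC n)" "m \<noteq> Map.empty"
    let ?u = "up_ind K {m}"
    have dom: "dom m \<subseteq> {1..n}"
      using m(1) by (fastforce simp: PC_iff)
    have "lin_ext K ?u f = lin_ext K ?u ?s"
    proof (cases "m \<subseteq>\<^sub>m Some")
      case True
      then have m_eq: "m = Some |` dom m"
        by (auto simp: map_le_def fun_eq_iff restrict_map_def domIff)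
      have "m \<subseteq>\<^sub>m \<one>\<^bsub>PC n\<^esub>"
        using True dom by (force simp: one_PC map_le_def)
      then have "lin_ext K ?u ?s = ?a"
        using a by (simp add: lin_ext_smult one_eq lin_ext_basis) (simp add: up_ind_def)
      then show ?thesis
        using central_up_ind_id[OF dom] m m_eq by simp
    next
      case False
      then have "\<not> m \<subseteq>\<^sub>m \<one>\<^bsub>PC n\<^esub>"
        using dom by (force simp: one_PC map_le_def)
      then have "lin_ext K ?u ?s = \<zero>\<^bsub>K\<^esub>"
        using a by (simp add: lin_ext_smult one_eq lin_ext_basis) (simp add: up_ind_def)
      then show ?thesis
        using central_up_ind_nonid[OF m(1) False] by simp
    qed
    moreover have "f = (f \<ominus>\<^bsub>A\<^esub> ?s) \<oplus>\<^bsub>A\<^esub> ?s"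
      using f s by (simp add: a_minus_def A.a_assoc A.l_neg)
    then have "lin_ext K ?u f = lin_ext K ?u (f \<ominus>\<^bsub>A\<^esub> ?s) \<oplus>\<^bsub>K\<^esub> lin_ext K ?u ?s"
      using f s lin_ext_add[of "f \<ominus>\<^bsub>A\<^esub> ?s" ?s ?u] by simp
    ultimately show "lin_ext K ?u (f \<ominus>\<^bsub>A\<^esub> ?s) = \<zero>\<^bsub>K\<^esub>"
      using f s by simp
  qed (use f s in simp)
  then show "I +>\<^bsub>A\<^esub> f = I +>\<^bsub>A\<^esub> ?s"
    using f s by (simp add: coset_eq_iff minus_apply)
qed

end

end

theorem lemma4p15:
  fixes K :: "('k, 'x) ring_scheme" and n :: nat
  assumes "field K" and "n \<ge> 1"
  shows "is_alg_iso K (monoid_algebra K (PC n))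
           (prod_algebra (base_algebra K) (contracted_algebra K (PC n) Map.empty))
         \<and> connected_algebra (base_algebra K)
         \<and> connected_algebra (contracted_algebra K (PC n) Map.empty)"
proof -
  interpret field K by fact
  interpret partial_catalan_algebra K n
    by (intro partial_catalan_algebra.intro cring_axioms)
  \<comment> \<open>Here \<open>n \<ge> 1\<close> enters: the point 1 tells the identity from the
    empty map. For \<open>n = 0\<close> they coincide and the contracted algebra is zero.\<close>
  have "(Some |` {1..n}) 1 \<noteq> (Map.empty :: nat \<rightharpoonup> nat) 1"
    using assms(2) by simp
  then have "\<one>\<^bsub>PC n\<^esub> \<noteq> Map.empty"
    unfolding one_PC by metis
  then have "connected_algebra Q"
    using domain_axioms by (intro connected_contracted_if_center_scalar central_scalar)
  then show ?thesis
    using augmentation_alg_iso connected_base_algebra[OF domain_axioms]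
    by (auto simp: is_alg_iso_def)
qed

end
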